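(* Let $U\subseteq\mathbb{R}^n$ be open and let $X$ be a smooth vector field on $U$ such that $\dot x=X(x)$ is a codimension-one dissipative dynamical system, i.e. there exist $k,p\in\mathbb{N}$ with $k+p=n-1$ and functions $I_1,\dots,I_k,D_1,\dots,D_p,h_1,\dots,h_p\in C^\infty(U,\mathbb{R})$ such that $$\mathcal{L}_XI_1=\dots=\mathcal{L}_XI_k=0,\qquad \mathcal{L}_XD_1=h_1D_1,\ \dots,\ \mathcal{L}_XD_p=h_pD_p .$$ Suppose that $\Gamma=\{\gamma(t)\in U:0\le t\le T\}$ is a $T$-periodic orbit of $\dot x=X(x)$ such that: (i) $\Gamma\subset ID^{-1}(\{0\})$, and $0\in\mathbb{R}^{n-1}$ is a regular value of the map $ID=(I_1,\dots,I_k,D_1,\dots,D_p):U\to\mathbb{R}^{n-1}$; (ii) the vectors $\nabla I_1(\gamma(t)),\dots,\nabla I_k(\gamma(t)),\nabla D_1(\gamma(t)),\dots,\nabla D_p(\gamma(t)),X(\gamma(t))$ are linearly independent for each $0\le t\le T$. Then the characteristic multipliers of the periodic orbit $\Gamma$ are $$\underbrace{1,\dots,1}_{k+1\ \text{times}},\ \exp\left(\int_0^Th_1(\gamma(s))\,ds\right),\ \dots,\ \exp\left(\int_0^Th_p(\gamma(s))\,ds\right).$$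
   Context: $\mathbb{N}$ includes $0$. $\mathcal{L}_X f=\langle X,\nabla f\rangle$ is the Lie derivative of a smooth function $f$ along $X$, where $\langle\cdot,\cdot\rangle$ is the standard inner product on $\mathbb{R}^n$ and $\nabla$ the corresponding gradient. For a $T$-periodic orbit $\Gamma=\{\gamma(t):0\le t\le T\}$ of $\dot x=X(x)$ (where $\gamma$ is a $T$-periodic solution), the characteristic multipliers of $\Gamma$ are the eigenvalues (listed with multiplicity) of the matrix $u(T)$, where $u(t)$ is the $n\times n$ matrix solution of the variational equation $\frac{du}{dt}=DX(\gamma(t))u(t)$, $u(0)=I_{n,n}$ (the $n\times n$ identity matrix). *)

theory Defs
  imports "HOL-Analysis.Analysis" "HOL-Computational_Algebra.Polynomial"
begin

text \<open>The smoothness predicates follow the AFP entry \<open>Smooth_Manifolds\<close>. They are meant for open \<open>U\<close>,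
  where derivatives do not depend on values outside \<open>U\<close>.\<close>

primrec C_k_on :: "nat \<Rightarrow> 'a::real_normed_vector set \<Rightarrow> ('a \<Rightarrow> 'b::real_normed_vector) \<Rightarrow> bool" where
  "C_k_on 0 U f \<longleftrightarrow> continuous_on U f"
| "C_k_on (Suc m) U f \<longleftrightarrow>
     (\<forall>x\<in>U. f differentiable (at x)) \<and>
     (\<forall>v. C_k_on m U (\<lambda>x. frechet_derivative f (at x) v))"

definition smooth_on :: "'a::real_normed_vector set \<Rightarrow> ('a \<Rightarrow> 'b::real_normed_vector) \<Rightarrow> bool" where
  "smooth_on U f \<longleftrightarrow> (\<forall>m. C_k_on m U f)"

definition grad :: "(real^'n \<Rightarrow> real) \<Rightarrow> real^'n \<Rightarrow> real^'n" where
  "grad f x = (THE d. GDERIV f x :> d)"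

definition lie_derivative :: "(real^'n \<Rightarrow> real^'n) \<Rightarrow> (real^'n \<Rightarrow> real) \<Rightarrow> real^'n \<Rightarrow> real" where
  "lie_derivative X f x = X x \<bullet> grad f x"

text \<open>Families \<open>I\<^sub>1, \<dots>, I\<^sub>k\<close> etc. are indexed from \<open>0\<close>: only \<open>I i\<close> with \<open>i < k\<close>, and \<open>D j\<close>, \<open>h j\<close> with
  \<open>j < p\<close>, are relevant. Both \<open>k = 0\<close> and \<open>p = 0\<close> are allowed.\<close>

definition codim_one_dissipative ::
  "(real^'n) set \<Rightarrow> (real^'n \<Rightarrow> real^'n) \<Rightarrow> nat \<Rightarrow> nat \<Rightarrow>
    (nat \<Rightarrow> real^'n \<Rightarrow> real) \<Rightarrow> (nat \<Rightarrow> real^'n \<Rightarrow> real) \<Rightarrow> (nat \<Rightarrow> real^'n \<Rightarrow> real) \<Rightarrow> bool" where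
  "codim_one_dissipative U X k p I D h \<longleftrightarrow>
     k + p + 1 = CARD('n) \<and>
     (\<forall>i<k. smooth_on U (I i)) \<and>
     (\<forall>j<p. smooth_on U (D j) \<and> smooth_on U (h j)) \<and>
     (\<forall>i<k. \<forall>x\<in>U. lie_derivative X (I i) x = 0) \<and>
     (\<forall>j<p. \<forall>x\<in>U. lie_derivative X (D j) x = h j x * D j x)"

text \<open>Since the dimension \<open>m = k + p\<close> of the target may be \<open>0\<close>, it cannot be the cardinality of a type.
  A point of \<open>\<real>\<^sup>m\<close> is therefore a function on \<open>nat\<close> of which only the values at \<open>j < m\<close> count.\<close>

definition ID_map ::
  "nat \<Rightarrow> (nat \<Rightarrow> 'a \<Rightarrow> real) \<Rightarrow> (nat \<Rightarrow> 'a \<Rightarrow> real) \<Rightarrow> 'a \<Rightarrow> nat \<Rightarrow> real" where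
  "ID_map k I D x j = (if j < k then I j x else D (j - k) x)"

definition fibre :: "'a set \<Rightarrow> nat \<Rightarrow> ('a \<Rightarrow> nat \<Rightarrow> real) \<Rightarrow> (nat \<Rightarrow> real) \<Rightarrow> 'a set" where
  "fibre U m F y = {x \<in> U. \<forall>j<m. F x j = y j}"

text \<open>The differential of \<open>F : U \<rightarrow> \<real>\<^sup>m\<close>, computed componentwise, is onto \<open>\<real>\<^sup>m\<close> at each point of the fibre.\<close>

definition regular_value ::
  "'a::real_normed_vector set \<Rightarrow> nat \<Rightarrow> ('a \<Rightarrow> nat \<Rightarrow> real) \<Rightarrow> (nat \<Rightarrow> real) \<Rightarrow> bool" where
  "regular_value U m F y \<longleftrightarrow>
     (\<forall>x\<in>fibre U m F y. \<forall>w. \<exists>v. \<forall>j<m. frechet_derivative (\<lambda>z. F z j) (at x) v = w j)"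

text \<open>Linear independence of a family rather than of the set of its members, so repetitions are excluded.\<close>

definition lin_indep_family :: "'a::real_vector list \<Rightarrow> bool" where
  "lin_indep_family vs \<longleftrightarrow> distinct vs \<and> independent (set vs)"

text \<open>The period \<open>T\<close> is not required to be minimal.\<close>

definition periodic_solution ::
  "(real^'n) set \<Rightarrow> (real^'n \<Rightarrow> real^'n) \<Rightarrow> real \<Rightarrow> (real \<Rightarrow> real^'n) \<Rightarrow> bool" where
  "periodic_solution U X T \<gamma> \<longleftrightarrow>
     T > 0 \<and>
     (\<forall>t. \<gamma> t \<in> U \<and> (\<gamma> has_vector_derivative X (\<gamma> t)) (at t)) \<and>
     (\<forall>t. \<gamma> (t + T) = \<gamma> t)"

text \<open>The initial value problem is linear with continuous coefficients (for smooth \<open>X\<close> and a solution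
  \<open>\<gamma>\<close> in \<open>U\<close>), so it has exactly one solution on \<open>\<real>\<close>.\<close>

definition variational_solution ::
  "(real^'n \<Rightarrow> real^'n) \<Rightarrow> (real \<Rightarrow> real^'n) \<Rightarrow> real \<Rightarrow> real^'n^'n" where
  "variational_solution X \<gamma> =
     (THE u. u 0 = mat 1 \<and>
        (\<forall>t. (u has_vector_derivative (jacobian X (at (\<gamma> t)) ** u t)) (at t)))"

definition charpoly :: "'a::comm_ring_1^'n^'n \<Rightarrow> 'a poly" where
  "charpoly A = det (\<chi> i j. (if i = j then [:0, 1:] else 0) - [:A $ i $ j:])"

text \<open>Eigenvalues of a real matrix are taken in \<open>\<complex>\<close>, with algebraic multiplicity.\<close>

definition eigenvalues_mset :: "real^'n^'n \<Rightarrow> complex multiset" where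
  "eigenvalues_mset A = proots (charpoly (\<chi> i j. complex_of_real (A $ i $ j)))"

definition characteristic_multipliers ::
  "(real^'n \<Rightarrow> real^'n) \<Rightarrow> real \<Rightarrow> (real \<Rightarrow> real^'n) \<Rightarrow> complex multiset" where
  "characteristic_multipliers X T \<gamma> = eigenvalues_mset (variational_solution X \<gamma> T)"

end

theory Submission
  imports Defs
begin

text \<open>
  Let \<open>M = u(T)\<close> be the monodromy matrix at \<open>x\<^sub>0 = \<gamma> 0 = \<gamma> T\<close>. Every one of the \<open>n - 1\<close>
  given functions satisfies an equation \<open>\<langle>X, \<nabla>f\<rangle> = h f\<close>, with \<open>h = 0\<close> for the first integrals \<open>I\<^sub>i\<close>, and
  vanishes on the orbit. Differentiating that equation at a point of the orbit, the term containing the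
  derivative of \<open>h\<close> drops out because \<open>f = 0\<close> there, and the symmetry of the Hessian of \<open>f\<close> turns the rest
  into \<open>w' = - J\<^sup>T w + h w\<close> for \<open>w t = \<nabla>f (\<gamma> t)\<close>, where \<open>J\<close> is the Jacobian of \<open>X\<close> along the orbit. So,
  up to the factor \<open>exp (\<integral> h)\<close>, the gradient solves the equation adjoint to the variational one, and its
  pairing with a variational solution only picks up that factor (\<open>gradient_along_orbit\<close>). Over one period
  this says that \<open>\<nabla>f (x\<^sub>0)\<close> is a left eigenvector of \<open>M\<close> with eigenvalue \<open>exp (\<integral>\<^sub>0\<^sup>T h)\<close>
  (\<open>monodromy_gradient\<close>): this gives \<open>k\<close> times \<open>1\<close> and the \<open>p\<close> exponentials.

  The remaining eigenvalue \<open>1\<close> comes from the velocity: \<open>X (\<gamma> t)\<close> solves the variational equation and is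
  periodic, so \<open>X x\<^sub>0\<close> is a right eigenvector (\<open>monodromy_velocity\<close>). It is orthogonal to all the
  gradients, because \<open>\<langle>X, \<nabla>f\<rangle> = h f = 0\<close> on the orbit. Take the gradients together with \<open>X x\<^sub>0\<close> as rows of
  an invertible matrix \<open>P\<close>. Then \<open>P M P\<^sup>-\<^sup>1\<close> is triangular with the claimed numbers on the diagonal, which
  gives the characteristic polynomial and therefore the algebraic multiplicities
  (\<open>eigenvalues_of_left_eigenvectors\<close>).

  The monodromy matrix is described as \<^emph>\<open>the\<close> solution of a linear initial value problem, so its use
  rests on existence and uniqueness for linear equations with continuous coefficients on the whole line
  (\<open>linear_ode_solvable\<close>, \<open>fundamental_matrix_unique\<close>).
\<close>

section \<open>Linear differential equations on the real line\<close>

text \<open>The oriented integral from \<open>0\<close> to \<open>t\<close> is differentiated by comparison: on \<open>(-R, R)\<close> it differs by a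
  constant from the integral over \<open>[-R, t]\<close>, whose lower limit lies to the left of every point in question.\<close>

lemma antiderivative_on_reals:
  fixes f :: "real \<Rightarrow> 'a::banach"
  assumes "continuous_on UNIV f"
  obtains F where "F 0 = 0" "\<And>t. (F has_vector_derivative f t) (at t)"
proof -
  define F where "F = (\<lambda>t. integral {0..t} f - integral {t..0} f)"
  have int: "f integrable_on {a..b}" for a b
    using assms continuous_on_subset integrable_continuous_real by blast
  have "(F has_vector_derivative f t) (at t)" for t
  proof -
    define R where "R = \<bar>t\<bar> + 1"
    have F_eq: "F s = integral {-R..s} f - integral {-R..0} f" if "s \<in> {-R<..<R}" for s
    proof (cases "s \<ge> 0")
      case True
      have "integral {-R..0} f + integral {0..s} f = integral {-R..s} f"
        using True by (intro Henstock_Kurzweil_Integration.integral_combine int) (auto simp: R_def)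
      moreover have "integral {s..0} f = 0"
        using True by (cases "s = 0") auto
      ultimately show ?thesis by (simp add: F_def algebra_simps)
    next
      case False
      have "integral {-R..s} f + integral {s..0} f = integral {-R..0} f"
        using False that by (intro Henstock_Kurzweil_Integration.integral_combine int) auto
      then show ?thesis using False by (simp add: F_def algebra_simps)
    qed
    have t: "t \<in> {-R<..<R}" by (auto simp: R_def)
    have "((\<lambda>s. integral {-R..s} f) has_vector_derivative f t) (at t within {-R..R})"
      using assms continuous_on_subset t by (intro integral_has_vector_derivative) auto
    then have "((\<lambda>s. integral {-R..s} f) has_vector_derivative f t) (at t)"
      using t at_within_Icc_at[of "-R" t R] by (auto)
    then have "((\<lambda>s. integral {-R..s} f - integral {-R..0} f) has_vector_derivative f t) (at t)"
      by (simp add: has_vector_derivative_diff_const)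
    then show ?thesis
      by (rule has_vector_derivative_transform_within_open[where S = "{-R<..<R}"])
        (use t F_eq in auto)
  qed
  moreover have "F 0 = 0" by (simp add: F_def)
  ultimately show thesis using that by blast
qed

text \<open>One step of the estimate for iterated integrals: each integration raises the exponent and
  divides by the next integer, which produces the factorials that make the Picard series converge.\<close>

lemma norm_antiderivative_le:
  fixes F :: "real \<Rightarrow> 'a::real_normed_vector"
  assumes F: "F 0 = 0" "\<And>t. (F has_vector_derivative f t) (at t)"
    and le: "\<And>t. \<bar>t\<bar> \<le> R \<Longrightarrow> norm (f t) \<le> a * c * (c * \<bar>t\<bar>) ^ n / fact n"
    and t: "\<bar>t\<bar> \<le> R"
  shows "norm (F t) \<le> a * (c * \<bar>t\<bar>) ^ Suc n / fact (Suc n)"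
proof -
  define \<phi> where "\<phi> = (\<lambda>s::real. a * (c * s) ^ Suc n / fact (Suc n))"
  have \<phi>': "(\<phi> has_vector_derivative (a * c * (c * s) ^ n / fact n)) (at s)" for s
  proof -
    have "(\<phi> has_real_derivative (a * (real (Suc n) * (c * s) ^ n * c) / fact (Suc n))) (at s)"
      unfolding \<phi>_def by (auto intro!: derivative_eq_intros simp del: fact_Suc power_Suc)
    also have "a * (real (Suc n) * (c * s) ^ n * c) / fact (Suc n) = a * c * (c * s) ^ n / fact n"
      by (simp add: field_simps del: of_nat_Suc)
    finally show ?thesis
      by (simp add: has_real_derivative_iff_has_vector_derivative)
  qed
  have main: "norm (G s - G 0) \<le> \<phi> s - \<phi> 0"
    if "0 < s" "s \<le> R" and G: "\<And>r. (G has_vector_derivative g r) (at r)"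
      and g: "\<And>r. \<bar>r\<bar> \<le> R \<Longrightarrow> norm (g r) \<le> a * c * (c * \<bar>r\<bar>) ^ n / fact n"
    for G :: "real \<Rightarrow> 'a" and g s
  proof (rule differentiable_bound_general[where f' = g and \<phi>' = "\<lambda>s. a * c * (c * s) ^ n / fact n"])
    show "continuous_on {0..s} G" "continuous_on {0..s} \<phi>"
      using G \<phi>' by (meson continuous_at_imp_continuous_on has_vector_derivative_continuous)+
    show "norm (g r) \<le> a * c * (c * r) ^ n / fact n" if "0 < r" "r < s" for r
      using g[of r] that \<open>s \<le> R\<close> by simp
  qed (use that \<phi>' in auto)
  consider "t = 0" | "t > 0" | "t < 0" by linarith
  then show ?thesis
  proof cases
    case 1 then show ?thesis using F by simp
  next
    case 2 then show ?thesis using main[OF 2 _ F(2) le] t F(1) by (simp add: \<phi>_def)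
  next
    case 3
    have "((\<lambda>s. F (- s)) has_vector_derivative - f (- s)) (at s)" for s
    proof -
      have "(uminus has_vector_derivative - 1) (at s)"
        by (auto intro!: derivative_eq_intros)
      from vector_diff_chain_at[OF this F(2)] show ?thesis by (simp add: o_def)
    qed
    moreover have "norm (- f (- r)) \<le> a * c * (c * \<bar>r\<bar>) ^ n / fact n" if "\<bar>r\<bar> \<le> R" for r
      using le[of "- r"] that by simp
    ultimately have "norm (F (- (- t)) - F (- 0)) \<le> \<phi> (- t) - \<phi> 0"
      by (rule main[rotated 2]) (use 3 t in auto)
    then show ?thesis using 3 F(1) by (simp add: \<phi>_def)
  qed
qed

text \<open>Picard iteration, written as a series: \<open>x = \<Sum> y\<^sub>n\<close>, where \<open>y\<^sub>0\<close> is constant and \<open>y\<^sub>n\<^sub>+\<^sub>1\<close> is the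
  antiderivative of \<open>A y\<^sub>n\<close> that vanishes at \<open>0\<close>. Linearity makes the solution global: on \<open>[-R, R]\<close> the
  terms are bounded by \<open>\<parallel>x0\<parallel> (c R)\<^sup>n / n!\<close>, so the series of derivatives converges uniformly there. The product
  is an arbitrary bounded bilinear map, which covers left and right multiplication of matrices at once.\<close>

lemma linear_ode_solvable:
  fixes A :: "real \<Rightarrow> 'a::real_normed_vector" and x0 :: "'b::banach"
  assumes bb: "bounded_bilinear mul" and A: "continuous_on UNIV A"
  obtains x where "x 0 = x0" "\<And>t. (x has_vector_derivative mul (A t) (x t)) (at t)"
proof -
  interpret P: bounded_bilinear mul by (rule bb)
  obtain K where K: "K > 0" "\<And>a b. norm (mul a b) \<le> norm a * norm b * K"
    using P.pos_bounded by blast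
  have "\<exists>F. F 0 = 0 \<and> (\<forall>t. (F has_vector_derivative f t) (at t))"
    if "continuous_on UNIV f" for f :: "real \<Rightarrow> 'b"
    using antiderivative_on_reals[OF that] by metis
  then obtain prim :: "(real \<Rightarrow> 'b) \<Rightarrow> real \<Rightarrow> 'b" where
    prim: "\<And>f. continuous_on UNIV f \<Longrightarrow> prim f 0 = 0"
      "\<And>f t. continuous_on UNIV f \<Longrightarrow> (prim f has_vector_derivative f t) (at t)"
    by metis
  define y where "y = rec_nat (\<lambda>_. x0) (\<lambda>_ f. prim (\<lambda>t. mul (A t) (f t)))"
  have y_0: "y 0 = (\<lambda>_. x0)" and y_Suc: "y (Suc n) = prim (\<lambda>t. mul (A t) (y n t))" for n
    by (simp_all add: y_def)
  have cont_y: "continuous_on UNIV (y n)" for n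
  proof (induction n)
    case (Suc n)
    then have "continuous_on UNIV (\<lambda>t. mul (A t) (y n t))"
      using A by (intro P.continuous_on)
    from prim(2)[OF this] show ?case
      unfolding y_Suc by (meson continuous_at_imp_continuous_on has_vector_derivative_continuous)
  qed (simp add: y_0)
  then have cont: "continuous_on UNIV (\<lambda>t. mul (A t) (y n t))" for n
    using A by (intro P.continuous_on)
  define y' where "y' = (\<lambda>n t. case n of 0 \<Rightarrow> 0 | Suc m \<Rightarrow> mul (A t) (y m t))"
  have y': "(y n has_vector_derivative y' n t) (at t)" for n t
    by (cases n) (simp_all add: y'_def y_0 y_Suc prim(2)[OF cont])
  have y_at_0: "y (Suc n) 0 = 0" for n
    by (simp add: y_Suc prim(1)[OF cont])

  have local_bounds: "\<exists>c\<ge>0. \<forall>n t. \<bar>t\<bar> \<le> R \<longrightarrow> norm (y n t) \<le> norm x0 * (c * R) ^ n / fact n \<and>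
      norm (y' (Suc n) t) \<le> norm x0 * c * (c * R) ^ n / fact n" if "R > 0" for R :: real
  proof -
    have "bounded (A ` {-R..R})"
      using A by (intro compact_imp_bounded compact_continuous_image) (auto intro: continuous_on_subset)
    then obtain B where "\<And>t. t \<in> {-R..R} \<Longrightarrow> norm (A t) \<le> B"
      unfolding bounded_iff by blast
    then have B: "norm (A t) \<le> B" if "\<bar>t\<bar> \<le> R" for t
      using that by (simp add: abs_le_iff minus_le_iff)
    define c where "c = B * K"
    have "B \<ge> 0" using order_trans[OF norm_ge_zero B[of 0]] that by simp
    then have c: "c \<ge> 0" using K by (simp add: c_def)
    have step: "norm (y' (Suc n) t) \<le> c * norm (y n t)" if "\<bar>t\<bar> \<le> R" for n t
    proof -
      have "norm (y' (Suc n) t) \<le> norm (A t) * norm (y n t) * K" by (simp add: y'_def K)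
      also have "\<dots> \<le> B * norm (y n t) * K"
        using B[OF that] K by (intro mult_right_mono) auto
      finally show ?thesis by (simp add: c_def mult_ac)
    qed
    have bd: "\<bar>t\<bar> \<le> R \<Longrightarrow> norm (y n t) \<le> norm x0 * (c * \<bar>t\<bar>) ^ n / fact n" for n t
    proof (induction n arbitrary: t)
      case (Suc n)
      show ?case
      proof (rule norm_antiderivative_le[OF y_at_0 y' _ Suc.prems])
        fix s assume s: "\<bar>s\<bar> \<le> R"
        have "norm (y' (Suc n) s) \<le> c * (norm x0 * (c * \<bar>s\<bar>) ^ n / fact n)"
          using step[OF s, of n] Suc.IH[OF s] c by (meson mult_left_mono order_trans)
        then show "norm (y' (Suc n) s) \<le> norm x0 * c * (c * \<bar>s\<bar>) ^ n / fact n"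
          by (simp add: mult_ac)
      qed
    qed (simp add: y_0)
    have bd': "norm (y n t) \<le> norm x0 * (c * R) ^ n / fact n" if "\<bar>t\<bar> \<le> R" for n t
    proof -
      have "norm x0 * (c * \<bar>t\<bar>) ^ n / fact n \<le> norm x0 * (c * R) ^ n / fact n"
        using that c by (intro divide_right_mono mult_left_mono power_mono) auto
      with bd[OF that, of n] show ?thesis by linarith
    qed
    have "norm (y' (Suc n) t) \<le> norm x0 * c * (c * R) ^ n / fact n" if "\<bar>t\<bar> \<le> R" for n t
      using order_trans[OF step[OF that, of n] mult_left_mono[OF bd'[OF that, of n] c]]
      by (simp add: mult_ac)
    with bd' c show ?thesis by blast
  qed
  have summable_exp_bound: "summable (\<lambda>n. M * (b ^ n / fact n))" for M b :: real
    using summable_exp[of b] by (intro summable_mult) (simp add: field_simps)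

  define x where "x = (\<lambda>t. \<Sum>n. y n t)"
  have summ: "summable (\<lambda>n. y n t)" for t
  proof -
    obtain c where "\<And>n s. \<bar>s\<bar> \<le> \<bar>t\<bar> + 1 \<Longrightarrow> norm (y n s) \<le> norm x0 * (c * (\<bar>t\<bar> + 1)) ^ n / fact n"
      using local_bounds[of "\<bar>t\<bar> + 1"] by (metis abs_ge_zero add_nonneg_pos zero_less_one)
    from this[of t] show ?thesis
      by (intro summable_comparison_test'[OF summable_exp_bound]) auto
  qed
  show thesis
  proof
    have "x 0 = (\<Sum>n. if n = 0 then x0 else 0)"
      unfolding x_def by (rule suminf_cong) (metis y_0 y_at_0 not0_implies_Suc)
    then show "x 0 = x0" using suminf_finite[of "{0}" "\<lambda>n. if n = (0::nat) then x0 else 0"] by simp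
  next
    fix t :: real
    define R where "R = \<bar>t\<bar> + 1"
    obtain c where c: "c \<ge> 0" "\<And>n s. \<bar>s\<bar> \<le> R \<Longrightarrow> norm (y n s) \<le> norm x0 * (c * R) ^ n / fact n"
       "\<And>n s. \<bar>s\<bar> \<le> R \<Longrightarrow> norm (y' (Suc n) s) \<le> norm x0 * c * (c * R) ^ n / fact n"
      using local_bounds[of R] unfolding R_def by (metis abs_ge_zero add_nonneg_pos zero_less_one)
    define S where "S = {-R<..<R}"
    have t: "t \<in> S" by (auto simp: R_def S_def)
    \<comment> \<open>A summable majorant for the derivatives; it is shifted by one because the constant \<open>y 0\<close>
      has derivative \<open>0\<close>.\<close>
    define M where "M = (\<lambda>n. case n of 0 \<Rightarrow> 0 | Suc m \<Rightarrow> norm x0 * c * ((c * R) ^ m / fact m))"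
    have M: "summable M"
      using summable_exp_bound[of "norm x0 * c" "c * R"] by (subst summable_Suc_iff[symmetric]) (simp add: M_def)
    have "norm (y' n s) \<le> M n" if "s \<in> S" for n s
      using that c(3)[of s "n - 1"] by (cases n) (auto simp: M_def S_def y'_def)
    from Weierstrass_m_test[OF this M]
    have unif: "uniform_limit S (\<lambda>n s. \<Sum>i<n. y' i s) (\<lambda>s. \<Sum>i. y' i s) sequentially" .
    have sum_y': "(\<Sum>i. y' i s) = mul (A s) (x s)" for s
    proof -
      have "(\<lambda>i. y' (Suc i) s) sums mul (A s) (x s)"
        unfolding y'_def x_def using P.bounded_linear_right[THEN bounded_linear.sums, OF summable_sums[OF summ]]
        by simp
      then have "(\<lambda>i. y' i s) sums (mul (A s) (x s))"
        using sums_Suc[of "\<lambda>i. y' i s"] by (fastforce simp: y'_def)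
      then show ?thesis by (simp add: sums_iff)
    qed
    have "\<exists>g. \<forall>s\<in>S. (\<lambda>n. y n s) sums g s \<and>
        (g has_derivative (\<lambda>h. h *\<^sub>R (\<Sum>i. y' i s))) (at s within S)"
    proof (rule has_derivative_series[where f' = "\<lambda>n s h. h *\<^sub>R y' n s"])
      show "convex S" by (simp add: S_def)
      show "(y n has_derivative (\<lambda>h. h *\<^sub>R y' n s)) (at s within S)" for n s
        using y'[of n s] by (simp add: has_vector_derivative_def has_derivative_at_withinI)
      fix e :: real assume "e > 0"
      then have "\<forall>\<^sub>F n in sequentially. \<forall>s\<in>S. norm ((\<Sum>i<n. y' i s) - (\<Sum>i. y' i s)) < e"
        using unif by (simp add: uniform_limit_iff dist_norm)
      then show "\<forall>\<^sub>F n in sequentially. \<forall>s\<in>S. \<forall>h.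
          norm ((\<Sum>i<n. h *\<^sub>R y' i s) - h *\<^sub>R (\<Sum>i. y' i s)) \<le> e * norm h"
      proof eventually_elim
        case (elim n)
        show ?case
        proof (intro ballI allI)
          fix s h assume "s \<in> S"
          have "norm ((\<Sum>i<n. h *\<^sub>R y' i s) - h *\<^sub>R (\<Sum>i. y' i s))
              = norm h * norm ((\<Sum>i<n. y' i s) - (\<Sum>i. y' i s))"
            by (simp flip: scaleR_sum_right scaleR_diff_right)
          also have "\<dots> \<le> norm h * e"
            using elim \<open>s \<in> S\<close> by (intro mult_left_mono) (auto simp: less_imp_le)
          finally show "norm ((\<Sum>i<n. h *\<^sub>R y' i s) - h *\<^sub>R (\<Sum>i. y' i s)) \<le> e * norm h"
            by (simp add: mult.commute)
        qed
      qed
    qed (use t summ in \<open>auto simp: summable_sums_iff\<close>)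
    then obtain g where g: "\<And>s. s \<in> S \<Longrightarrow> (\<lambda>n. y n s) sums g s"
      "\<And>s. s \<in> S \<Longrightarrow> (g has_vector_derivative mul (A s) (x s)) (at s within S)"
      by (auto simp: has_vector_derivative_def sum_y')
    have "(g has_vector_derivative mul (A t) (x t)) (at t)"
      using g(2)[OF t] t at_within_open[of t S] by (simp add: S_def)
    then show "(x has_vector_derivative mul (A t) (x t)) (at t)"
      by (rule has_vector_derivative_transform_within_open[where S = S])
        (use t g(1) in \<open>auto simp: S_def x_def sums_iff\<close>)
  qed
qed

lemma bounded_bilinear_matrix_matrix_mult:
  "bounded_bilinear ((**) :: real^'n^'m \<Rightarrow> real^'l^'n \<Rightarrow> real^'l^'m)"
proof -
  have "bilinear ((**) :: real^'n^'m \<Rightarrow> real^'l^'n \<Rightarrow> real^'l^'m)"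
    unfolding bilinear_def
    by (auto intro!: linearI simp: matrix_add_ldistrib matrix_scalar_ac scalar_matrix_assoc)
      (simp_all add: matrix_matrix_mult_def vec_eq_iff sum.distrib distrib_right)
  then show ?thesis by (simp add: bilinear_conv_bounded_bilinear)
qed

lemma bounded_bilinear_matrix_vector_mult:
  "bounded_bilinear ((*v) :: real^'n^'m \<Rightarrow> real^'n \<Rightarrow> real^'m)"
proof -
  have "bilinear ((*v) :: real^'n^'m \<Rightarrow> real^'n \<Rightarrow> real^'m)"
    unfolding bilinear_def
    by (auto intro!: linearI simp: algebra_simps scaleR_matrix_vector_assoc matrix_vector_mult_scaleR)
  then show ?thesis by (simp add: bilinear_conv_bounded_bilinear)
qed

lemma adjoint_equation_solvable:
  fixes A :: "real \<Rightarrow> real^'n^'n"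
  assumes A: "continuous_on UNIV A"
  obtains v where "v 0 = mat 1" "\<And>t. (v has_vector_derivative - (v t ** A t)) (at t)"
proof -
  have "continuous_on UNIV (\<lambda>t. - A t)" using A by (rule continuous_on_minus)
  from linear_ode_solvable[OF bounded_bilinear.flip[OF bounded_bilinear_matrix_matrix_mult] this]
  obtain v :: "real \<Rightarrow> real^'n^'n" where v: "v 0 = mat 1"
    "\<And>t. (v has_vector_derivative v t ** (- A t)) (at t)" by metis
  have "(v has_vector_derivative - (v t ** A t)) (at t)" for t
    using v(2)[of t] by (simp add: bounded_bilinear.minus_right[OF bounded_bilinear_matrix_matrix_mult])
  with v(1) show thesis by (rule that)
qed

text \<open>The two derivatives \<open>- (v A) x\<close> and \<open>v (A x)\<close> cancel. It is stated for two products so as to apply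
  to matrix as well as to vector solutions \<open>x\<close>.\<close>

lemma adjoint_times_solution_const:
  fixes A :: "real \<Rightarrow> real^'n^'n" and x :: "real \<Rightarrow> 'b::real_normed_vector"
  assumes bb: "bounded_bilinear mul"
    and assoc: "\<And>B C y. mul (B ** C) y = mul B (mul' C y)"
    and v: "\<And>t. (v has_vector_derivative - (v t ** A t)) (at t)"
    and x: "\<And>t. (x has_vector_derivative mul' (A t) (x t)) (at t)"
  shows "mul (v t) (x t) = mul (v 0) (x 0)"
proof -
  have "((\<lambda>t. mul (v t) (x t)) has_vector_derivative
      mul (v t) (mul' (A t) (x t)) + mul (- (v t ** A t)) (x t)) (at t within UNIV)" for t
    using v x by (intro bounded_bilinear.has_vector_derivative[OF bb]) auto
  then have "((\<lambda>t. mul (v t) (x t)) has_vector_derivative 0) (at t within UNIV)" for t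
    by (simp add: bounded_bilinear.minus_left[OF bb] assoc)
  then show ?thesis
    using has_vector_derivative_zero_constant[of UNIV "\<lambda>t. mul (v t) (x t)"] by (metis UNIV_I convex_UNIV)
qed

text \<open>A solution \<open>v\<close> of the adjoint equation is a left inverse of \<^emph>\<open>every\<close> fundamental matrix normalised
  at \<open>0\<close>, so any two of these are the inverse of the same matrix.\<close>

lemma fundamental_matrix_unique:
  fixes A :: "real \<Rightarrow> real^'n^'n"
  assumes A: "continuous_on UNIV A"
  shows "\<exists>!u. u 0 = mat 1 \<and> (\<forall>t. (u has_vector_derivative A t ** u t) (at t))"
proof -
  obtain u where u: "u 0 = mat 1" "\<And>t. (u has_vector_derivative A t ** u t) (at t)"
    using linear_ode_solvable[OF bounded_bilinear_matrix_matrix_mult A] by metis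
  obtain v where v: "v 0 = mat 1" "\<And>t. (v has_vector_derivative - (v t ** A t)) (at t)"
    using adjoint_equation_solvable[OF A] by metis
  have inv: "v t ** w t = mat 1"
    if "w 0 = mat 1" "\<And>t. (w has_vector_derivative A t ** w t) (at t)" for w t
    using adjoint_times_solution_const[OF bounded_bilinear_matrix_matrix_mult
        matrix_mul_assoc[symmetric] v(2) that(2)] that(1) v(1)
    by simp
  have "w = u" if "w 0 = mat 1" "\<And>t. (w has_vector_derivative A t ** w t) (at t)" for w
  proof
    fix t :: real
    have "u t ** v t = mat 1" using inv[OF u] matrix_left_right_inverse by blast
    then show "w t = u t"
      using inv[OF that, of t] matrix_mul_assoc[of "u t" "v t" "w t"] by simp
  qed
  with u show ?thesis by blast
qed

text \<open>Multiplying by the adjoint solution \<open>v = u\<^sup>-\<^sup>1\<close> makes every solution constant.\<close>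

lemma linear_ode_solution_eq_fundamental_matrix:
  fixes A :: "real \<Rightarrow> real^'n^'n"
  assumes A: "continuous_on UNIV A"
    and u: "u 0 = mat 1" "\<And>t. (u has_vector_derivative A t ** u t) (at t)"
    and x: "\<And>t. (x has_vector_derivative A t *v x t) (at t)"
  shows "x t = u t *v x 0"
proof -
  obtain v where v: "v 0 = mat 1" "\<And>t. (v has_vector_derivative - (v t ** A t)) (at t)"
    using adjoint_equation_solvable[OF A] by metis
  have "v t ** u t = mat 1"
    using adjoint_times_solution_const[OF bounded_bilinear_matrix_matrix_mult
        matrix_mul_assoc[symmetric] v(2) u(2)] u(1) v(1) by simp
  then have "u t ** v t = mat 1" using matrix_left_right_inverse by blast
  moreover have "v t *v x t = x 0"
    using adjoint_times_solution_const[OF bounded_bilinear_matrix_vector_mult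
        matrix_vector_mul_assoc[symmetric] v(2) x] v(1) by simp
  ultimately show ?thesis
    using matrix_vector_mul_assoc[of "u t" "v t" "x t"] by simp
qed

section \<open>Symmetry of the second derivative and gradients\<close>

lemma has_real_derivative_along_line:
  fixes f :: "'a::real_normed_vector \<Rightarrow> real"
  assumes "f differentiable (at (c + t *\<^sub>R v))"
  shows "((\<lambda>t. f (c + t *\<^sub>R v)) has_real_derivative frechet_derivative f (at (c + t *\<^sub>R v)) v) (at t)"
proof -
  let ?f' = "frechet_derivative f (at (c + t *\<^sub>R v))"
  have f': "(f has_derivative ?f') (at (c + t *\<^sub>R v))"
    by (rule frechet_derivative_works[THEN iffD1, OF assms])
  have "((\<lambda>t. c + t *\<^sub>R v) has_derivative (\<lambda>h. h *\<^sub>R v)) (at t)"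
    by (auto intro!: derivative_eq_intros)
  from has_derivative_compose[OF this f']
  have "((\<lambda>t. f (c + t *\<^sub>R v)) has_derivative (\<lambda>h. ?f' (h *\<^sub>R v))) (at t)" .
  moreover have "?f' (h *\<^sub>R v) = ?f' v * h" for h
    using linear_scale[OF has_derivative_linear[OF f']] by simp
  ultimately show ?thesis by (simp add: has_field_derivative_def)
qed

text \<open>The mean value theorem, applied first in the direction \<open>v\<close> and then in the direction \<open>w\<close>. The left-hand
  side is symmetric in \<open>v\<close> and \<open>w\<close>, the right-hand side is not: this is the source of the symmetry
  below.\<close>

lemma second_difference_mean_value:
  fixes f :: "'a::real_normed_vector \<Rightarrow> real"
  assumes f': "\<And>y. y \<in> U \<Longrightarrow> f differentiable (at y)"
    and f'': "\<And>y. y \<in> U \<Longrightarrow> (\<lambda>z. frechet_derivative f (at z) v) differentiable (at y)"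
    and s: "s > 0" and sub: "cball x (s * (norm v + norm w)) \<subseteq> U"
  obtains y where "y \<in> cball x (s * (norm v + norm w))"
    "f (x + s *\<^sub>R v + s *\<^sub>R w) - f (x + s *\<^sub>R v) - f (x + s *\<^sub>R w) + f x =
      s\<^sup>2 * frechet_derivative (\<lambda>z. frechet_derivative f (at z) v) (at y) w"
proof -
  have in_cball: "x + a *\<^sub>R v + b *\<^sub>R w \<in> cball x (s * (norm v + norm w))"
    if "0 \<le> a" "a \<le> s" "0 \<le> b" "b \<le> s" for a b
  proof -
    have "norm (a *\<^sub>R v + b *\<^sub>R w) \<le> a * norm v + b * norm w"
      using norm_triangle_ineq[of "a *\<^sub>R v" "b *\<^sub>R w"] that by simp
    also have "\<dots> \<le> s * norm v + s * norm w"
      using that by (intro add_mono mult_right_mono) auto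
    finally show ?thesis
      by (simp add: dist_commute[of x]) (simp add: dist_norm add.assoc distrib_left)
  qed
  define \<phi> where "\<phi> = (\<lambda>a. f ((x + s *\<^sub>R w) + a *\<^sub>R v) - f (x + a *\<^sub>R v))"
  have "(\<phi> has_real_derivative frechet_derivative f (at ((x + s *\<^sub>R w) + a *\<^sub>R v)) v
      - frechet_derivative f (at (x + a *\<^sub>R v)) v) (at a)" if "0 \<le> a" "a \<le> s" for a
    unfolding \<phi>_def
  proof (intro DERIV_diff has_real_derivative_along_line f')
    show "x + s *\<^sub>R w + a *\<^sub>R v \<in> U"
      using in_cball[of a s] sub that s by (auto simp: add_ac)
    show "x + a *\<^sub>R v \<in> U"
      using in_cball[of a 0] sub that s by auto
  qed
  from MVT2[OF s this] obtain a where a: "0 < a" "a < s" "\<phi> s - \<phi> 0 =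
      (s - 0) * (frechet_derivative f (at ((x + s *\<^sub>R w) + a *\<^sub>R v)) v
        - frechet_derivative f (at (x + a *\<^sub>R v)) v)"
    by blast
  define \<psi> where "\<psi> = (\<lambda>b. frechet_derivative f (at ((x + a *\<^sub>R v) + b *\<^sub>R w)) v)"
  have "(\<psi> has_real_derivative frechet_derivative (\<lambda>z. frechet_derivative f (at z) v)
      (at (x + a *\<^sub>R v + b *\<^sub>R w)) w) (at b)" if "0 \<le> b" "b \<le> s" for b
    unfolding \<psi>_def using a that in_cball[of a b] sub
    by (intro has_real_derivative_along_line[where f = "\<lambda>z. frechet_derivative f (at z) v"] f'') auto
  from MVT2[OF s this] obtain b where b: "0 < b" "b < s" "\<psi> s - \<psi> 0 =
      (s - 0) * frechet_derivative (\<lambda>z. frechet_derivative f (at z) v)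
        (at (x + a *\<^sub>R v + b *\<^sub>R w)) w"
    by blast
  show thesis
  proof (rule that)
    show "x + a *\<^sub>R v + b *\<^sub>R w \<in> cball x (s * (norm v + norm w))"
      using a b by (intro in_cball) auto
    show "f (x + s *\<^sub>R v + s *\<^sub>R w) - f (x + s *\<^sub>R v) - f (x + s *\<^sub>R w) + f x =
        s\<^sup>2 * frechet_derivative (\<lambda>z. frechet_derivative f (at z) v) (at (x + a *\<^sub>R v + b *\<^sub>R w)) w"
      using a(3) b(3) by (simp add: \<phi>_def \<psi>_def add_ac power2_eq_square)
  qed
qed

text \<open>The theorem of Clairaut and Schwarz. The second difference equals \<open>s\<^sup>2\<close> times either mixed derivative,
  each taken at some point close to \<open>x\<close>; by continuity the two derivatives at \<open>x\<close> cannot differ by a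
  positive amount \<open>2 e\<close>.\<close>

lemma second_derivative_symmetric:
  fixes f :: "'a::real_normed_vector \<Rightarrow> real"
  assumes "open U" and f: "C_k_on 2 U f" and x: "x \<in> U"
  shows "frechet_derivative (\<lambda>y. frechet_derivative f (at y) v) (at x) w =
         frechet_derivative (\<lambda>y. frechet_derivative f (at y) w) (at x) v"
proof (rule ccontr)
  let ?D = "\<lambda>v w x. frechet_derivative (\<lambda>y. frechet_derivative f (at y) v) (at x) w"
  assume "?D v w x \<noteq> ?D w v x"
  define e where "e = \<bar>?D v w x - ?D w v x\<bar> / 2"
  have e: "e > 0" using \<open>?D v w x \<noteq> ?D w v x\<close> by (simp add: e_def)
  have f': "\<And>y. y \<in> U \<Longrightarrow> f differentiable (at y)"
    and f'': "\<And>y v. y \<in> U \<Longrightarrow> (\<lambda>z. frechet_derivative f (at z) v) differentiable (at y)"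
    and cont: "\<And>v w. continuous_on U (?D v w)"
    using f by (auto simp: numeral_2_eq_2)
  have near: "\<exists>d>0. \<forall>y\<in>U. dist y x < d \<longrightarrow> \<bar>?D v w y - ?D v w x\<bar> < e" for v w
    using cont[of v w] x e unfolding continuous_on_iff dist_real_def by blast
  obtain d1 where d1: "d1 > 0" "\<And>y. y \<in> U \<Longrightarrow> dist y x < d1 \<Longrightarrow> \<bar>?D v w y - ?D v w x\<bar> < e"
    using near by blast
  obtain d2 where d2: "d2 > 0" "\<And>y. y \<in> U \<Longrightarrow> dist y x < d2 \<Longrightarrow> \<bar>?D w v y - ?D w v x\<bar> < e"
    using near by blast
  obtain r where r: "r > 0" "cball x r \<subseteq> U"
    using \<open>open U\<close> x open_contains_cball by blast
  \<comment> \<open>The step \<open>s\<close> is so small that all points in question lie in \<open>U\<close> and within \<open>d1\<close> and \<open>d2\<close> of \<open>x\<close>.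
    The summand \<open>1\<close> in the denominator allows for \<open>v = w = 0\<close>.\<close>
  define m where "m = min r (min (d1/2) (d2/2))"
  define s where "s = m / (norm v + norm w + 1)"
  have m: "m > 0" "m \<le> r" "m < d1" "m < d2"
    using r d1 d2 by (auto simp: m_def min_def)
  have pos: "norm v + norm w + 1 > 0"
    by (simp add: add_nonneg_pos)
  then have s: "s > 0" using m by (simp add: s_def)
  have "s * (norm v + norm w + 1) = m" using pos by (simp add: s_def)
  then have le: "s * (norm v + norm w) \<le> m" using s by (simp add: distrib_left)
  then have sub: "cball x (s * (norm v + norm w)) \<subseteq> U" "cball x (s * (norm w + norm v)) \<subseteq> U"
    using r m subset_cball[of "s * (norm v + norm w)" r x] by (auto simp: add.commute)
  let ?\<Delta> = "f (x + s *\<^sub>R v + s *\<^sub>R w) - f (x + s *\<^sub>R v) - f (x + s *\<^sub>R w) + f x"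
  obtain y where y: "y \<in> cball x (s * (norm v + norm w))" "?\<Delta> = s\<^sup>2 * ?D v w y"
    using second_difference_mean_value[OF f' f'' s sub(1)] by metis
  obtain z where z: "z \<in> cball x (s * (norm w + norm v))"
    "f (x + s *\<^sub>R w + s *\<^sub>R v) - f (x + s *\<^sub>R w) - f (x + s *\<^sub>R v) + f x = s\<^sup>2 * ?D w v z"
    using second_difference_mean_value[OF f' f'' s sub(2)] by metis
  have "?\<Delta> = s\<^sup>2 * ?D w v z" using z(2) by (simp add: add_ac)
  with y(2) s have "?D v w y = ?D w v z" by simp
  moreover have "\<bar>?D v w y - ?D v w x\<bar> < e"
    using y(1) sub le m by (intro d1) (auto simp: dist_commute)
  moreover have "\<bar>?D w v z - ?D w v x\<bar> < e"
    using z(1) sub le m by (intro d2) (auto simp: dist_commute add.commute)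
  ultimately have "\<bar>?D v w x - ?D w v x\<bar> < 2 * e" by linarith
  then show False by (simp add: e_def)
qed

text \<open>The vector that represents the derivative has the partial derivatives as coordinates.\<close>

lemma GDERIV_grad:
  fixes f :: "real^'n \<Rightarrow> real"
  assumes "f differentiable (at x)"
  shows "GDERIV f x :> grad f x"
proof -
  let ?f' = "frechet_derivative f (at x)"
  have f': "(f has_derivative ?f') (at x)"
    by (rule frechet_derivative_works[THEN iffD1, OF assms])
  have "?f' = (\<lambda>v. v \<bullet> (\<Sum>b\<in>Basis. ?f' b *\<^sub>R b))"
  proof
    fix v
    have "?f' v = ?f' (\<Sum>b\<in>Basis. (v \<bullet> b) *\<^sub>R b)" by (simp add: euclidean_representation)
    also have "\<dots> = v \<bullet> (\<Sum>b\<in>Basis. ?f' b *\<^sub>R b)"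
      using has_derivative_linear[OF f'] by (simp add: linear_sum linear_scale inner_sum_right mult.commute)
    finally show "?f' v = v \<bullet> (\<Sum>b\<in>Basis. ?f' b *\<^sub>R b)" .
  qed
  with f' have *: "GDERIV f x :> (\<Sum>b\<in>Basis. ?f' b *\<^sub>R b)" by (simp add: gderiv_def)
  have "grad f x = (\<Sum>b\<in>Basis. ?f' b *\<^sub>R b)"
    unfolding grad_def
  proof (rule the_equality)
    show "GDERIV f x :> (\<Sum>b\<in>Basis. ?f' b *\<^sub>R b)" by (rule *)
  next
    fix d assume "GDERIV f x :> d"
    then have "(\<lambda>h. h \<bullet> d) = (\<lambda>h. h \<bullet> (\<Sum>b\<in>Basis. ?f' b *\<^sub>R b))"
      using * unfolding gderiv_def by (rule has_derivative_unique)
    then show "d = (\<Sum>b\<in>Basis. ?f' b *\<^sub>R b)"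
      unfolding fun_eq_iff by (rule vector_eq_ldot[THEN iffD1])
  qed
  with * show ?thesis by simp
qed

lemma inner_grad:
  fixes f :: "real^'n \<Rightarrow> real"
  assumes "f differentiable (at x)"
  shows "v \<bullet> grad f x = frechet_derivative f (at x) v"
  using frechet_derivative_at[OF GDERIV_grad[OF assms, unfolded gderiv_def]] by (rule fun_cong)

text \<open>Only directional second derivatives are known to exist. They assemble to a derivative of the gradient
  because in finite dimension the gradient is a finite combination of partial derivatives; self-adjointness
  is the symmetry of mixed derivatives.\<close>

lemma hessian_exists:
  fixes f :: "real^'n \<Rightarrow> real"
  assumes "open U" and f: "C_k_on 2 U f" and x: "x \<in> U"
  obtains H where "(grad f has_derivative H) (at x)" "\<And>v w. v \<bullet> H w = w \<bullet> H v"
proof -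
  let ?D = "\<lambda>v w. frechet_derivative (\<lambda>y. frechet_derivative f (at y) v) (at x) w"
  have f': "\<And>y. y \<in> U \<Longrightarrow> f differentiable (at y)"
    and f'': "\<And>v. (\<lambda>z. frechet_derivative f (at z) v) differentiable (at x)"
    using f x by (auto simp: numeral_2_eq_2)
  define H where "H = (\<lambda>w. \<Sum>b\<in>Basis. ?D b w *\<^sub>R b)"
  have "((\<lambda>y. \<Sum>b\<in>Basis. frechet_derivative f (at y) b *\<^sub>R b) has_derivative H) (at x)"
    unfolding H_def
    by (intro has_derivative_sum has_derivative_scaleR_left frechet_derivative_works[THEN iffD1] f'')
  moreover have "(\<Sum>b\<in>Basis. frechet_derivative f (at y) b *\<^sub>R b) = grad f y" if "y \<in> U" for y
    using euclidean_representation[of "grad f y"] inner_grad[OF f'[OF that]]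
    by (simp add: inner_commute)
  ultimately have grad': "(grad f has_derivative H) (at x)"
    by (rule has_derivative_transform_within_open[OF _ \<open>open U\<close> x])
  have H: "v \<bullet> H w = ?D v w" for v w
  proof -
    have "((\<lambda>y. v \<bullet> grad f y) has_derivative (\<lambda>w. v \<bullet> H w)) (at x)"
      using grad' by (rule has_derivative_inner_right)
    then have "((\<lambda>y. frechet_derivative f (at y) v) has_derivative (\<lambda>w. v \<bullet> H w)) (at x)"
      by (rule has_derivative_transform_within_open[OF _ \<open>open U\<close> x]) (simp add: inner_grad f')
    then have "(\<lambda>w. v \<bullet> H w) = ?D v" by (rule frechet_derivative_at)
    then show ?thesis by (rule fun_cong)
  qed
  have "v \<bullet> H w = w \<bullet> H v" for v w
    unfolding H by (rule second_derivative_symmetric[OF assms])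
  with grad' show thesis by (rule that)
qed

section \<open>Gradients of semi-invariants along an orbit\<close>

text \<open>Both sides of \<open>\<langle>X, \<nabla>f\<rangle> = h f\<close> are differentiated in the direction \<open>v\<close>. On the zero set of \<open>f\<close> the
  term with the derivative of \<open>h\<close> disappears; this is why the orbit has to lie in that set.\<close>

lemma hessian_of_semi_invariant:
  fixes f :: "real^'n \<Rightarrow> real" and X :: "real^'n \<Rightarrow> real^'n"
  assumes "open U" and x: "x \<in> U"
    and lie: "\<And>y. y \<in> U \<Longrightarrow> lie_derivative X f y = h y * f y"
    and f: "f differentiable (at x)" and h: "h differentiable (at x)" and X: "(X has_derivative X') (at x)"
    and H: "(grad f has_derivative H) (at x)" and zero: "f x = 0"
  shows "X x \<bullet> H v + X' v \<bullet> grad f x = h x * (v \<bullet> grad f x)"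
proof -
  obtain h' where h': "(h has_derivative h') (at x)" using h by (auto simp: differentiable_def)
  have f': "(f has_derivative (\<lambda>v. v \<bullet> grad f x)) (at x)"
    using GDERIV_grad[OF f] by (simp add: gderiv_def)
  have "((\<lambda>y. X y \<bullet> grad f y) has_derivative (\<lambda>v. X x \<bullet> H v + X' v \<bullet> grad f x)) (at x)"
    using X H by (rule has_derivative_inner)
  then have "((\<lambda>y. h y * f y) has_derivative (\<lambda>v. X x \<bullet> H v + X' v \<bullet> grad f x)) (at x)"
    by (rule has_derivative_transform_within_open[OF _ \<open>open U\<close> x])
      (use lie in \<open>simp add: lie_derivative_def\<close>)
  moreover have "((\<lambda>y. h y * f y) has_derivative (\<lambda>v. h x * (v \<bullet> grad f x) + h' v * f x)) (at x)"
    using h' f' by (rule has_derivative_mult)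
  ultimately have "(\<lambda>v. X x \<bullet> H v + X' v \<bullet> grad f x) = (\<lambda>v. h x * (v \<bullet> grad f x) + h' v * f x)"
    by (rule has_derivative_unique)
  from fun_cong[OF this, of v] show ?thesis using zero by simp
qed

text \<open>The preceding identity and the symmetry of the Hessian give \<open>\<langle>y, \<nabla>f\<rangle>' = h \<langle>y, \<nabla>f\<rangle>\<close> along the orbit,
  for each solution \<open>y\<close> of the variational equation; the integrating factor \<open>exp (- \<integral> h)\<close> makes the pairing
  constant.\<close>

lemma gradient_along_orbit:
  fixes f h :: "real^'n \<Rightarrow> real" and X :: "real^'n \<Rightarrow> real^'n"
  assumes "open U" and f: "C_k_on 2 U f" and h: "\<And>x. x \<in> U \<Longrightarrow> h differentiable (at x)"
    and X: "\<And>x. x \<in> U \<Longrightarrow> X differentiable (at x)"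
    and lie: "\<And>x. x \<in> U \<Longrightarrow> lie_derivative X f x = h x * f x"
    and \<gamma>: "\<And>t. \<gamma> t \<in> U" "\<And>t. (\<gamma> has_vector_derivative X (\<gamma> t)) (at t)"
    and zero: "\<And>t. t \<in> {0..T} \<Longrightarrow> f (\<gamma> t) = 0" and "0 \<le> T"
    and y: "\<And>t. (y has_vector_derivative jacobian X (at (\<gamma> t)) *v y t) (at t)"
  shows "y T \<bullet> grad f (\<gamma> T) = exp (integral {0..T} (\<lambda>s. h (\<gamma> s))) * (y 0 \<bullet> grad f (\<gamma> 0))"
proof -
  define \<eta> where "\<eta> = (\<lambda>t. integral {0..t} (\<lambda>s. h (\<gamma> s)))"
  have "continuous (at t) (\<lambda>s. h (\<gamma> s))" for t
    using has_vector_derivative_continuous[OF \<gamma>(2), of t]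
      differentiable_imp_continuous_within[OF h[OF \<gamma>(1), of t]]
    by (rule isCont_o2)
  then have "continuous_on {0..T} (\<lambda>s. h (\<gamma> s))"
    by (simp add: continuous_at_imp_continuous_on)
  then have \<eta>': "(\<eta> has_real_derivative h (\<gamma> t)) (at t within {0..T})" if "t \<in> {0..T}" for t
    unfolding \<eta>_def using that by (rule integral_has_real_derivative)
  have f': "\<And>x. x \<in> U \<Longrightarrow> f differentiable (at x)" using f by (simp add: numeral_2_eq_2)
  have const: "((\<lambda>t. exp (- \<eta> t) * (y t \<bullet> grad f (\<gamma> t))) has_vector_derivative 0) (at t within {0..T})"
    if t: "t \<in> {0..T}" for t
  proof -
    obtain H where H: "(grad f has_derivative H) (at (\<gamma> t))" "\<And>v w. v \<bullet> H w = w \<bullet> H v"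
      using hessian_exists[OF \<open>open U\<close> f \<gamma>(1)] by metis
    let ?J = "jacobian X (at (\<gamma> t))"
    have X': "(X has_derivative (\<lambda>v. ?J *v v)) (at (\<gamma> t))"
      by (rule jacobian_works[THEN iffD1, OF X[OF \<gamma>(1)]])
    have "((\<lambda>t. grad f (\<gamma> t)) has_derivative (\<lambda>r. H (r *\<^sub>R X (\<gamma> t)))) (at t within {0..T})"
      using has_derivative_at_withinI[OF \<gamma>(2)[of t, unfolded has_vector_derivative_def]] H(1)
      by (rule has_derivative_compose)
    then have grad': "((\<lambda>t. grad f (\<gamma> t)) has_vector_derivative H (X (\<gamma> t))) (at t within {0..T})"
      by (simp add: has_vector_derivative_def linear_scale[OF has_derivative_linear[OF H(1)]])
    have "((\<lambda>t. y t \<bullet> grad f (\<gamma> t)) has_vector_derivative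
        (y t \<bullet> H (X (\<gamma> t)) + (?J *v y t) \<bullet> grad f (\<gamma> t))) (at t within {0..T})"
      using has_vector_derivative_at_within[OF y[of t]] grad'
      by (rule bounded_bilinear.has_vector_derivative[OF bounded_bilinear_inner])
    moreover have "y t \<bullet> H (X (\<gamma> t)) + (?J *v y t) \<bullet> grad f (\<gamma> t) = h (\<gamma> t) * (y t \<bullet> grad f (\<gamma> t))"
      using hessian_of_semi_invariant[OF \<open>open U\<close> \<gamma>(1) lie f'[OF \<gamma>(1)] h[OF \<gamma>(1)] X' H(1) zero[OF t], of "y t"]
      by (simp add: H(2)[of "y t" "X (\<gamma> t)"])
    ultimately have "((\<lambda>t. y t \<bullet> grad f (\<gamma> t)) has_real_derivative h (\<gamma> t) * (y t \<bullet> grad f (\<gamma> t)))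
        (at t within {0..T})"
      by (simp add: has_real_derivative_iff_has_vector_derivative)
    from DERIV_mult[OF DERIV_chain2[OF DERIV_exp DERIV_minus[OF \<eta>'[OF t]]] this]
    have "((\<lambda>t. exp (- \<eta> t) * (y t \<bullet> grad f (\<gamma> t))) has_real_derivative 0) (at t within {0..T})"
      by (simp add: algebra_simps)
    then show ?thesis by (simp add: has_real_derivative_iff_has_vector_derivative)
  qed
  obtain c where "\<And>t. t \<in> {0..T} \<Longrightarrow> exp (- \<eta> t) * (y t \<bullet> grad f (\<gamma> t)) = c"
    using has_vector_derivative_zero_constant[OF convex_real_interval(5) const] by blast
  then have "exp (- \<eta> T) * (y T \<bullet> grad f (\<gamma> T)) = exp (- \<eta> 0) * (y 0 \<bullet> grad f (\<gamma> 0))"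
    using \<open>0 \<le> T\<close> by auto
  moreover have "\<eta> 0 = 0" by (simp add: \<eta>_def)
  ultimately have "y T \<bullet> grad f (\<gamma> T) = exp (\<eta> T) * (y 0 \<bullet> grad f (\<gamma> 0))"
    by (simp add: exp_minus field_simps)
  then show ?thesis by (simp add: \<eta>_def)
qed

section \<open>Eigenvalues from a basis of left eigenvectors and one right eigenvector\<close>

text \<open>Such a matrix is triangular in a suitable order of the indices, but an arbitrary finite index type
  carries no order. In the Leibniz formula only permutations that fix every index other than \<open>r\<close> contribute,
  and such a permutation is the identity.\<close>

lemma det_diagonal_except_row:
  fixes A :: "'a::comm_ring_1^'n^'n"
  assumes A: "\<And>i j. i \<noteq> r \<Longrightarrow> i \<noteq> j \<Longrightarrow> A $ i $ j = 0"
  shows "det A = (\<Prod>i\<in>UNIV. A $ i $ i)"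
proof -
  have "(\<Prod>i\<in>UNIV. A $ i $ \<pi> i) = 0" if "\<pi> permutes UNIV" "\<pi> \<noteq> id" for \<pi>
  proof -
    have "\<exists>i. i \<noteq> r \<and> \<pi> i \<noteq> i"
    proof (rule ccontr)
      assume "\<not> ?thesis"
      then have fixed: "\<pi> i = i" if "i \<noteq> r" for i using that by blast
      then have "\<pi> r = r"
        using permutes_inj[OF \<open>\<pi> permutes UNIV\<close>] by (metis injD)
      with fixed \<open>\<pi> \<noteq> id\<close> show False by (metis eq_id_iff)
    qed
    then obtain i where i: "i \<noteq> r" "\<pi> i \<noteq> i" by blast
    have "A $ i $ \<pi> i = 0" using A[OF i(1), of "\<pi> i"] i(2) by simp
    then have "\<exists>i\<in>UNIV. A $ i $ \<pi> i = 0" by blast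
    then show ?thesis by (intro prod_zero) simp
  qed
  then have "det A = (\<Sum>\<pi>\<in>{id}. of_int (sign \<pi>) * (\<Prod>i\<in>UNIV. A $ i $ \<pi> i))"
    unfolding det_def
    by (intro sum.mono_neutral_right) (auto simp: finite_permutations permutes_id)
  then show ?thesis by simp
qed

lemma charpoly_diagonal_except_row:
  fixes A :: "'a::comm_ring_1^'n^'n"
  assumes "\<And>i j. i \<noteq> r \<Longrightarrow> i \<noteq> j \<Longrightarrow> A $ i $ j = 0"
  shows "charpoly A = (\<Prod>i\<in>UNIV. [:- (A $ i $ i), 1:])"
  unfolding charpoly_def by (subst det_diagonal_except_row[of r]) (auto simp: assms)

text \<open>With an indeterminate \<open>z\<close>, the relation \<open>P A = B P\<close> persists for \<open>z - A\<close> and \<open>z - B\<close> over the polynomial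
  ring, and \<open>det P\<close> is a unit there, so it can be cancelled.\<close>

lemma charpoly_similar:
  fixes A B P Q :: "'a::idom^'n^'n"
  assumes PA: "P ** A = B ** P" and PQ: "P ** Q = mat 1"
  shows "charpoly A = charpoly B"
proof -
  \<comment> \<open>The embedding of scalar matrices into polynomial matrices is multiplicative.\<close>
  define c :: "'a^'n^'n \<Rightarrow> 'a poly^'n^'n" where "c = (\<lambda>A. \<chi> i j. [:A $ i $ j:])"
  have sum_pCons: "(\<Sum>i\<in>S. [:g i:]) = [:sum g S:]" for g :: "'n \<Rightarrow> 'a" and S
    by (induction S rule: infinite_finite_induct) auto
  have c_mult: "c (A ** B) = c A ** c B" for A B
    by (simp add: c_def matrix_matrix_mult_def vec_eq_iff sum_pCons mult.commute)
  have charpoly: "charpoly A = det (mat [:0, 1:] - c A)" for A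
    unfolding charpoly_def by (rule arg_cong[where f = det]) (simp add: vec_eq_iff mat_def c_def)
  have "c P ** (mat [:0, 1:] - c A) = (mat [:0, 1:] - c B) ** c P"
  proof -
    have "c P ** mat [:0, 1:] = mat [:0, 1:] ** c P"
      by (simp add: matrix_matrix_mult_def mat_def vec_eq_iff mult_delta_left mult_delta_right mult.commute)
    moreover have "c P ** c A = c B ** c P" using PA by (simp flip: c_mult)
    moreover have "C ** (E - F) = C ** E - C ** F" "(E - F) ** C = E ** C - F ** C"
      for C E F :: "'a poly^'n^'n"
      by (simp_all add: matrix_matrix_mult_def vec_eq_iff sum_subtractf algebra_simps)
    ultimately show ?thesis by simp
  qed
  from arg_cong[OF this, of det] have "det (c P) * charpoly A = charpoly B * det (c P)"
    by (simp add: det_mul charpoly)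
  moreover have "det (c P) * det (c Q) = 1"
  proof -
    have "c (mat 1) = mat 1" by (simp add: c_def mat_def vec_eq_iff)
    then have "c P ** c Q = mat 1" using PQ by (simp flip: c_mult)
    from arg_cong[OF this, of det] show ?thesis by (simp add: det_mul)
  qed
  ultimately show ?thesis
    by (metis mult.commute mult_cancel_left mult_zero_left zero_neq_one)
qed

text \<open>Let \<open>P\<close> have the rows \<open>w i\<close>, and \<open>L = P M P\<^sup>-\<^sup>1\<close>. A left eigenvector \<open>w i\<close> makes row \<open>i\<close> of \<open>L\<close> equal to
  \<open>\<mu> i\<close> times a unit vector. Row \<open>r\<close> may be arbitrary off the diagonal. Its diagonal entry is \<open>\<mu> r\<close> because
  the orthogonality relations identify column \<open>r\<close> of \<open>P\<^sup>-\<^sup>1\<close> as a multiple of the right eigenvector \<open>w r\<close>.\<close>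

lemma eigenvalues_of_left_eigenvectors:
  fixes M :: "real^'n^'n" and w :: "'n \<Rightarrow> real^'n" and \<mu> :: "'n \<Rightarrow> real"
  assumes left: "\<And>i y. i \<noteq> r \<Longrightarrow> (M *v y) \<bullet> w i = \<mu> i * (y \<bullet> w i)"
    and right: "M *v w r = \<mu> r *\<^sub>R w r"
    and orth: "\<And>i. i \<noteq> r \<Longrightarrow> w i \<bullet> w r = 0"
    and indep: "inj w" "independent (range w)"
  shows "eigenvalues_mset M = image_mset (\<lambda>i. complex_of_real (\<mu> i)) (mset_set UNIV)"
proof -
  define P :: "real^'n^'n" where "P = (\<chi> i. w i)"
  have "\<exists>Q. P ** Q = mat 1"
    unfolding matrix_right_invertible_independent_rows
  proof (intro allI impI)
    fix c i
    assume *: "(\<Sum>i\<in>UNIV. c i *s row i P) = 0"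
    have "row i P = w i" for i by (simp add: P_def row_def vec_eq_iff)
    with * have "(\<Sum>v\<in>range w. c (inv w v) *\<^sub>R v) = 0"
      using indep(1) by (simp add: sum.reindex scalar_mult_eq_scaleR)
    from independentD[OF indep(2) _ _ this, of "w i"] show "c i = 0"
      using indep(1) by simp
  qed
  then obtain Q where PQ: "P ** Q = mat 1" by blast
  then have QP: "Q ** P = mat 1" using matrix_left_right_inverse by blast
  define L where "L = P ** M ** Q"
  have PM: "P ** M = L ** P"
    by (simp add: L_def QP flip: matrix_mul_assoc)
  have L_entry: "L $ i $ j = (M *v column j Q) \<bullet> w i" for i j
  proof -
    have "L $ i $ j = (P *v (M *v column j Q)) $ i"
      by (simp add: L_def matrix_vector_mul_assoc flip: matrix_vector_mult_basis)
        (simp add: matrix_vector_mult_basis column_def matrix_mul_assoc)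
    also have "\<dots> = (M *v column j Q) \<bullet> w i"
      by (simp add: matrix_vector_mul_component P_def inner_commute)
    finally show ?thesis .
  qed
  have dual: "column j Q \<bullet> w i = (if i = j then 1 else 0)" for i j
  proof -
    have "column j Q \<bullet> w i = (P ** Q) $ i $ j"
      by (simp add: P_def matrix_matrix_mult_def column_def inner_vec_def mult.commute)
    then show ?thesis by (simp add: PQ mat_def)
  qed
  have L_off: "L $ i $ j = 0" if "i \<noteq> r" "i \<noteq> j" for i j
    using that by (simp add: L_entry left dual)
  have "w r \<bullet> w r \<noteq> 0"
    using indep(2) dependent_zero by (metis inner_eq_zero_iff rangeI)
  have L_diag: "L $ i $ i = \<mu> i" for i
  proof (cases "i = r")
    case False
    then show ?thesis by (simp add: L_entry left dual)
  next
    case True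
    have "column r Q = w r /\<^sub>R (w r \<bullet> w r)"
    proof -
      have "P *v w r = (w r \<bullet> w r) *\<^sub>R axis r 1"
        by (auto simp: vec_eq_iff matrix_vector_mul_component P_def axis_def orth)
      then have "Q *v (P *v w r) = (w r \<bullet> w r) *\<^sub>R column r Q"
        by (simp add: matrix_vector_mult_scaleR matrix_vector_mult_basis)
      then have "w r = (w r \<bullet> w r) *\<^sub>R column r Q"
        by (simp add: matrix_vector_mul_assoc QP)
      then show ?thesis
        using \<open>w r \<bullet> w r \<noteq> 0\<close> by (metis scaleR_scaleR left_inverse scaleR_one)
    qed
    then show ?thesis
      using True \<open>w r \<bullet> w r \<noteq> 0\<close> by (simp add: L_entry matrix_vector_mult_scaleR right)
  qed
  define cx :: "real^'n^'n \<Rightarrow> complex^'n^'n" where "cx = (\<lambda>A. \<chi> i j. complex_of_real (A $ i $ j))"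
  have cx_mult: "cx (A ** B) = cx A ** cx B" for A B
    by (simp add: cx_def matrix_matrix_mult_def vec_eq_iff)
  have "cx (mat 1) = mat 1" by (simp add: cx_def mat_def vec_eq_iff)
  then have "charpoly (cx M) = charpoly (cx L)"
    using PM PQ by (intro charpoly_similar[of "cx P" _ _ "cx Q"]) (simp_all flip: cx_mult)
  also have "\<dots> = (\<Prod>i\<in>UNIV. [:- (cx L $ i $ i), 1:])"
    by (rule charpoly_diagonal_except_row[of r]) (simp add: cx_def L_off)
  also have "\<dots> = (\<Prod>i\<in>UNIV. [:- complex_of_real (\<mu> i), 1:])"
    by (simp add: cx_def L_diag)
  finally have "proots (charpoly (cx M)) = (\<Sum>i\<in>UNIV. {#complex_of_real (\<mu> i)#})"
    by (simp add: proots_prod)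
  then show ?thesis
    by (simp add: eigenvalues_mset_def cx_def sum_unfold_sum_mset)
qed

section \<open>The monodromy matrix of a periodic orbit\<close>

lemma continuous_on_jacobian:
  fixes X :: "real^'n \<Rightarrow> real^'m"
  assumes "C_k_on 1 U X"
  shows "continuous_on U (\<lambda>x. jacobian X (at x))"
proof -
  have "continuous_on U (\<lambda>x. frechet_derivative X (at x) v)" for v
    using assms by simp
  then show ?thesis
    unfolding jacobian_def matrix_def
    by (intro continuous_on_vec_lambda continuous_on_component)
qed

text \<open>Since the fundamental matrix is unique, the definite description has the intended meaning.\<close>

lemma variational_solution_works:
  fixes X :: "real^'n \<Rightarrow> real^'n"
  assumes X: "C_k_on 1 U X"
    and \<gamma>: "\<And>t. \<gamma> t \<in> U" "\<And>t. (\<gamma> has_vector_derivative X (\<gamma> t)) (at t)"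
  shows "continuous_on UNIV (\<lambda>t. jacobian X (at (\<gamma> t)))"
    and "variational_solution X \<gamma> 0 = mat 1"
    and "(variational_solution X \<gamma> has_vector_derivative
           jacobian X (at (\<gamma> t)) ** variational_solution X \<gamma> t) (at t)"
proof -
  have "continuous_on UNIV \<gamma>"
    using has_vector_derivative_continuous[OF \<gamma>(2)] by (simp add: continuous_at_imp_continuous_on)
  then show cont: "continuous_on UNIV (\<lambda>t. jacobian X (at (\<gamma> t)))"
    by (rule continuous_on_compose2[OF continuous_on_jacobian[OF X]]) (use \<gamma>(1) in auto)
  from theI'[OF fundamental_matrix_unique[OF this]]
  show "variational_solution X \<gamma> 0 = mat 1"
    and "(variational_solution X \<gamma> has_vector_derivative
           jacobian X (at (\<gamma> t)) ** variational_solution X \<gamma> t) (at t)"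
    unfolding variational_solution_def by auto
qed

text \<open>The chain rule shows that the velocity \<open>X (\<gamma> t)\<close> of the orbit solves the variational equation, and
  periodicity brings it back to its initial value.\<close>

lemma monodromy_velocity:
  fixes X :: "real^'n \<Rightarrow> real^'n"
  assumes X: "C_k_on 1 U X" and per: "periodic_solution U X T \<gamma>"
  shows "variational_solution X \<gamma> T *v X (\<gamma> 0) = X (\<gamma> 0)"
proof -
  have \<gamma>: "\<And>t. \<gamma> t \<in> U" "\<And>t. (\<gamma> has_vector_derivative X (\<gamma> t)) (at t)" and T: "\<gamma> T = \<gamma> 0"
    using per unfolding periodic_solution_def by (auto dest: spec[of _ 0])
  note u = variational_solution_works[OF X \<gamma>]
  have "((\<lambda>t. X (\<gamma> t)) has_vector_derivative jacobian X (at (\<gamma> t)) *v X (\<gamma> t)) (at t)" for t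
  proof -
    have "X differentiable (at (\<gamma> t))" using X \<gamma>(1) by simp
    then have "(X has_derivative (\<lambda>v. jacobian X (at (\<gamma> t)) *v v)) (at (\<gamma> t))"
      by (rule jacobian_works[THEN iffD1])
    from has_derivative_compose[OF \<gamma>(2)[of t, unfolded has_vector_derivative_def] this]
    show ?thesis by (simp add: has_vector_derivative_def matrix_vector_mult_scaleR)
  qed
  from linear_ode_solution_eq_fundamental_matrix[OF u this, of T] show ?thesis by (simp add: T)
qed

text \<open>In matrix terms: \<open>\<nabla>f (\<gamma> 0)\<close> is a left eigenvector of the monodromy matrix.\<close>

lemma monodromy_gradient:
  fixes f h :: "real^'n \<Rightarrow> real" and X :: "real^'n \<Rightarrow> real^'n"
  assumes "open U" and X: "C_k_on 1 U X" and f: "C_k_on 2 U f"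
    and h: "\<And>x. x \<in> U \<Longrightarrow> h differentiable (at x)"
    and lie: "\<And>x. x \<in> U \<Longrightarrow> lie_derivative X f x = h x * f x"
    and per: "periodic_solution U X T \<gamma>" and zero: "\<And>t. t \<in> {0..T} \<Longrightarrow> f (\<gamma> t) = 0"
  shows "(variational_solution X \<gamma> T *v v) \<bullet> grad f (\<gamma> 0) =
           exp (integral {0..T} (\<lambda>s. h (\<gamma> s))) * (v \<bullet> grad f (\<gamma> 0))"
proof -
  have \<gamma>: "\<And>t. \<gamma> t \<in> U" "\<And>t. (\<gamma> has_vector_derivative X (\<gamma> t)) (at t)" and T: "\<gamma> T = \<gamma> 0" "0 \<le> T"
    using per unfolding periodic_solution_def by (auto dest: spec[of _ 0])
  note u = variational_solution_works[OF X \<gamma>]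
  have X': "\<And>x. x \<in> U \<Longrightarrow> X differentiable (at x)" using X by simp
  have "((\<lambda>t. variational_solution X \<gamma> t *v v) has_vector_derivative
      jacobian X (at (\<gamma> t)) *v (variational_solution X \<gamma> t *v v)) (at t)" for t
    using bounded_linear.has_vector_derivative[OF
        bounded_bilinear.bounded_linear_left[OF bounded_bilinear_matrix_vector_mult, of v] u(3)]
    by (simp add: matrix_vector_mul_assoc)
  from gradient_along_orbit[OF \<open>open U\<close> f h X' lie \<gamma> zero T(2) this]
  show ?thesis by (simp add: T u(2))
qed

lemma lin_indep_family_nth:
  assumes "lin_indep_family vs" and "bij_betw e UNIV {0..<length vs}"
  shows "inj (\<lambda>i. vs ! e i)" "independent (range (\<lambda>i. vs ! e i))"
proof -
  have "distinct vs" "independent (set vs)"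
    using assms(1) by (auto simp: lin_indep_family_def)
  have lt: "e i < length vs" for i using bij_betwE[OF assms(2)] by auto
  show "inj (\<lambda>i. vs ! e i)"
    using bij_betw_imp_inj_on[OF assms(2)] lt nth_eq_iff_index_eq[OF \<open>distinct vs\<close>]
    by (auto simp: inj_on_def)
  show "independent (range (\<lambda>i. vs ! e i))"
    by (rule independent_mono[OF \<open>independent (set vs)\<close>]) (use lt in auto)
qed

theorem theorem3p2:
  fixes U :: "(real^'n) set" and X :: "real^'n \<Rightarrow> real^'n"
    and k p :: nat and I D h :: "nat \<Rightarrow> real^'n \<Rightarrow> real"
    and T :: real and \<gamma> :: "real \<Rightarrow> real^'n" and \<Gamma> :: "(real^'n) set"
  assumes "open U" and "smooth_on U X"
    and "codim_one_dissipative U X k p I D h"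
    and "periodic_solution U X T \<gamma>" and "\<Gamma> = \<gamma> ` {0..T}"
    and "\<Gamma> \<subseteq> fibre U (k + p) (ID_map k I D) (\<lambda>_. 0)"
    and "regular_value U (k + p) (ID_map k I D) (\<lambda>_. 0)"
    and "\<forall>t\<in>{0..T}. lin_indep_family
           (map (\<lambda>i. grad (I i) (\<gamma> t)) [0..<k] @ map (\<lambda>j. grad (D j) (\<gamma> t)) [0..<p] @ [X (\<gamma> t)])"
  shows "characteristic_multipliers X T \<gamma> =
           replicate_mset (k + 1) 1 +
           image_mset (\<lambda>j. complex_of_real (exp (integral {0..T} (\<lambda>s. h j (\<gamma> s))))) (mset_set {..<p})"
proof -
  let ?M = "variational_solution X \<gamma> T"
  define \<rho> where "\<rho> = (\<lambda>j. exp (integral {0..T} (\<lambda>s. h j (\<gamma> s))))"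
  \<comment> \<open>First integrals and dissipated functions are treated alike: \<open>F n\<close> has the cofactor \<open>H n\<close>. The lists
    \<open>vs\<close> and \<open>\<mu>s\<close> contain the rows of the matrix \<open>P\<close> and their eigenvalues, the velocity being the last row.\<close>
  define F where "F = (\<lambda>n x. ID_map k I D x n)"
  define H where "H = (\<lambda>n. if n < k then (\<lambda>_. 0) else h (n - k))"
  define vs where "vs = map (\<lambda>i. grad (I i) (\<gamma> 0)) [0..<k] @ map (\<lambda>j. grad (D j) (\<gamma> 0)) [0..<p] @ [X (\<gamma> 0)]"
  define \<mu>s where "\<mu>s = replicate k 1 @ map \<rho> [0..<p] @ [1]"
  have T: "0 < T" and \<gamma>: "\<And>t. \<gamma> t \<in> U"
    using assms(4) by (auto simp: periodic_solution_def)
  have X: "C_k_on 1 U X" using assms(2) by (simp add: smooth_on_def)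
  note cod = assms(3)[unfolded codim_one_dissipative_def]
  have len: "length vs = Suc (k + p)" "CARD('n) = Suc (k + p)" "length \<mu>s = Suc (k + p)"
    using cod by (auto simp: vs_def \<mu>s_def)
  have F: "C_k_on 2 U (F n)" and H: "\<And>x. x \<in> U \<Longrightarrow> H n differentiable (at x)"
    and lie: "\<And>x. x \<in> U \<Longrightarrow> lie_derivative X (F n) x = H n x * F n x"
    and zero: "\<And>t. t \<in> {0..T} \<Longrightarrow> F n (\<gamma> t) = 0" if n: "n < k + p" for n
  proof -
    have "smooth_on U (F n)"
      using cod n by (cases "n < k") (auto simp: F_def ID_map_def)
    then show "C_k_on 2 U (F n)" by (simp add: smooth_on_def)
    have "C_k_on 1 U (h (n - k))" if "\<not> n < k"
      using cod n that unfolding smooth_on_def by (metis add.commute less_diff_conv2 not_le)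
    then show "H n differentiable (at x)" if "x \<in> U" for x
      using that by (simp add: H_def)
    show "lie_derivative X (F n) x = H n x * F n x" if "x \<in> U" for x
      using cod n that by (cases "n < k") (auto simp: F_def H_def ID_map_def)
    show "F n (\<gamma> t) = 0" if "t \<in> {0..T}" for t
    proof -
      have "\<gamma> t \<in> fibre U (k + p) (ID_map k I D) (\<lambda>_. 0)" using assms(5,6) that by blast
      then show ?thesis using n by (simp add: fibre_def F_def)
    qed
  qed
  have vs_nth: "vs ! n = grad (F n) (\<gamma> 0)" and \<mu>s_nth: "\<mu>s ! n = exp (integral {0..T} (\<lambda>s. H n (\<gamma> s)))"
    if "n < k + p" for n
    using that by (auto simp: vs_def \<mu>s_def F_def H_def ID_map_def[abs_def] \<rho>_def nth_append)
  have last: "vs ! (k + p) = X (\<gamma> 0)" "\<mu>s ! (k + p) = 1"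
    by (auto simp: vs_def \<mu>s_def nth_append)
  \<comment> \<open>Coordinates are numbered by \<open>e\<close>, and \<open>r\<close> is the one that belongs to the velocity.\<close>
  obtain e :: "'n \<Rightarrow> nat" where e: "bij_betw e UNIV {0..<Suc (k + p)}"
    using ex_bij_betw_finite_nat[of "UNIV :: 'n set"] len by auto
  obtain r where r: "e r = k + p"
    using e by (metis atLeastLessThan_iff bij_betw_iff_bijections le0 lessI)
  have e_lt: "e i < k + p" if "i \<noteq> r" for i
  proof -
    have "e i \<noteq> k + p" using that r e by (metis UNIV_I bij_betw_imp_inj_on inj_onD)
    moreover have "e i < Suc (k + p)" using bij_betwE[OF e] by simp
    ultimately show ?thesis by simp
  qed
  have "eigenvalues_mset ?M = image_mset (\<lambda>i. complex_of_real (\<mu>s ! e i)) (mset_set UNIV)"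
  proof (rule eigenvalues_of_left_eigenvectors[where r = r and w = "\<lambda>i. vs ! e i"])
    show "(?M *v y) \<bullet> vs ! e i = \<mu>s ! e i * (y \<bullet> vs ! e i)" if "i \<noteq> r" for i y
      using monodromy_gradient[OF assms(1) X F H lie assms(4) zero] e_lt[OF that]
      by (simp add: vs_nth \<mu>s_nth)
    show "?M *v vs ! e r = \<mu>s ! e r *\<^sub>R vs ! e r"
      using monodromy_velocity[OF X assms(4)] by (simp add: r last)
    show "vs ! e i \<bullet> vs ! e r = 0" if "i \<noteq> r" for i
      using lie[OF e_lt[OF that] \<gamma>[of 0]] zero[OF e_lt[OF that], of 0] T
      by (simp add: vs_nth[OF e_lt[OF that]] r last lie_derivative_def inner_commute)
    have "lin_indep_family vs" using assms(8) T by (auto simp: vs_def)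
    from lin_indep_family_nth[OF this] e len
    show "inj (\<lambda>i. vs ! e i)" "independent (range (\<lambda>i. vs ! e i))" by auto
  qed
  also have "\<dots> = image_mset (\<lambda>n. complex_of_real (\<mu>s ! n)) (image_mset e (mset_set UNIV))"
    by (simp add: multiset.map_comp o_def)
  also have "image_mset e (mset_set UNIV) = mset [0..<length \<mu>s]"
    using e len by (simp add: image_mset_mset_set bij_betw_def del: upt_Suc)
  also have "image_mset (\<lambda>n. complex_of_real (\<mu>s ! n)) (mset [0..<length \<mu>s]) = mset (map complex_of_real \<mu>s)"
    by (simp only: mset_map[symmetric]) (simp add: map_nth flip: map_map[unfolded o_def])
  also have "\<dots> = replicate_mset (k + 1) 1 + image_mset (\<lambda>j. complex_of_real (\<rho> j)) (mset_set {..<p})"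
    by (simp add: \<mu>s_def multiset.map_comp o_def atLeast0LessThan)
  finally show ?thesis by (simp add: characteristic_multipliers_def \<rho>_def)
qed

end
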